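(* For $n = 4$, let $\Sigma^{\cos}$ be the $4\times 4$ matrix with entries $\Sigma^{\cos}_{ij} = \cos(\pi(i-j)/4)$ for $1 \le i,j \le 4$, and let $\Sigma^{\Delta}$ be the $4 \times 4$ matrix with $\Sigma^{\Delta}_{ii} = 1$ and $\Sigma^{\Delta}_{ij} = -\tfrac{1}{3}$ for $i \neq j$. Then $$\mathbb{E}[M(\Sigma^{\cos})^2] < \mathbb{E}[M(\Sigma^{\Delta})^2].$$ Thus the assertion "for every $n \times n$ correlation matrix $\Sigma$, $\mathbb{E}[M(\Sigma^{\Delta})^p] \le \mathbb{E}[M(\Sigma)^p]$" is false for $n = 4$ and $p = 2$.
   Context: An $n\times n$ correlation matrix is a real symmetric positive semidefinite matrix $\Sigma$ with $\Sigma_{ii} = 1$ for all $i = 1,\dots,n$. For an $n \times n$ correlation matrix $\Sigma$, let $z \sim \mathcal{N}(0, I_n)$ be a standard Gaussian vector and define the random variable $M(\Sigma) = \min_{i=1}^n |(\Sigma^{1/2} z)_i|$; equivalently, $M(\Sigma)$ has the law of $\min_{i=1}^n |g_i|$ where $g \sim \mathcal{N}(0,\Sigma)$ is a centered Gaussian vector with covariance $\Sigma$. Both $\Sigma^{\cos}$ and $\Sigma^{\Delta}$ are correlation matrices. *)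

theory Defs
  imports "HOL-Probability.Probability"
begin

definition psd_matrix :: "real^'n^'n \<Rightarrow> bool" where
  "psd_matrix A \<longleftrightarrow> transpose A = A \<and> (\<forall>x. 0 \<le> x \<bullet> (A *v x))"

definition correlation_matrix :: "real^'n^'n \<Rightarrow> bool" where
  "correlation_matrix A \<longleftrightarrow> psd_matrix A \<and> (\<forall>i. A $ i $ i = 1)"

text \<open>The positive semidefinite square root. It exists and is unique whenever \<open>A\<close> is
  positive semidefinite; on other matrices the value is unspecified.\<close>
definition psd_sqrt :: "real^'n^'n \<Rightarrow> real^'n^'n" where
  "psd_sqrt A = (THE B. psd_matrix B \<and> B ** B = A)"

definition std_gaussian :: "(real^'n) measure" where
  "std_gaussian = density lborel (\<lambda>z. ennreal (\<Prod>i\<in>UNIV. std_normal_density (z $ i)))"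

definition min_abs :: "real^'n^'n \<Rightarrow> real^'n \<Rightarrow> real" where
  "min_abs A z = Min (range (\<lambda>i. \<bar>(psd_sqrt A *v z) $ i\<bar>))"

text \<open>The elements of the index type \<open>4\<close> are the residues modulo 4. As in the library's
  \<open>vector [a, b, c, d]\<close>, they are read as the indices 1, 2, 3, 4, with 4 represented
  by the residue 0; \<open>index_of\<close> returns this natural number.\<close>
definition index_of :: "4 \<Rightarrow> nat" where
  "index_of i = (THE k. k \<in> {1..4} \<and> of_nat k = i)"

definition Sigma_cos :: "real^4^4" where
  "Sigma_cos = (\<chi> i j. cos (pi * (real (index_of i) - real (index_of j)) / 4))"

definition Sigma_simplex :: "real^4^4" where
  "Sigma_simplex = (\<chi> i j. if i = j then 1 else - 1 / 3)"

lemma index_of_nat: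
  assumes "k \<in> {1..4}"
  shows "index_of (of_nat k) = k"
  unfolding index_of_def
proof (rule the_equality)
  show "k \<in> {1..4} \<and> (of_nat k :: 4) = of_nat k"
    using assms by simp
next
  fix m :: nat
  assume m: "m \<in> {1..4} \<and> (of_nat m :: 4) = of_nat k"
  have "{1..4::nat} = {1, 2, 3, 4}" by auto
  with m assms have "m \<in> {1, 2, 3, 4}" "k \<in> {1, 2, 3, 4}" by blast+
  with m show "m = k" by auto
qed

lemma Sigma_cos_nth:
  assumes "k \<in> {1..4}" "l \<in> {1..4}"
  shows "Sigma_cos $ of_nat k $ of_nat l = cos (pi * (real k - real l) / 4)"
  using assms by (simp add: Sigma_cos_def index_of_nat)

end

theory Submission
  imports Defs "HOL-Real_Asymp.Real_Asymp"
begin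

text \<open>
  Both matrices satisfy \<open>A ** A = c *\<^sub>R A\<close>, so their square roots are \<open>A / sqrt c\<close>, and a
  rotation of the Gaussian vector reduces the minimum to two, respectively three, independent
  standard normal coordinates.

  For \<open>Sigma_cos\<close> the minimum is the distance of a planar Gaussian point to four lines at angles
  \<open>pi / 4\<close>. It is homogeneous in the point, so the integral is one-dimensional in the slope, and the
  second moment is \<open>1 - 2 * sqrt 2 / pi\<close> (only the upper bound is needed).

  For \<open>Sigma_simplex\<close> the four linear forms are \<open>(\<plusminus>a \<plusminus> b \<plusminus> c) / sqrt 3\<close> up to sign. With
  \<open>p \<ge> q \<ge> r\<close> the sorted absolute values of the coordinates, the squared minimum is
  \<open>(p - q - r)\<^sup>2 / 3\<close>, that is \<open>(p\<^sup>2 + q\<^sup>2 + r\<^sup>2 - 2 * (p * q + p * r + q * r) + 4 * q * r) / 3\<close>.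
  The expectation of the product of the two smaller values follows by conditioning on the largest,
  and the second moment is \<open>1 + (4 - 8 * sqrt 2 + 8 / sqrt 3) / pi\<close> (only the lower bound is needed).
  The difference of the two values is \<open>(4 - 6 * sqrt 2 + 8 / sqrt 3) / pi > 0\<close>.
\<close>

section \<open>Square roots of scaled projections\<close>

text \<open>Here \<open>A / c\<close> is an orthogonal projection, so
  \<open>c * (x \<bullet> (A *v x))\<close> is the squared norm of \<open>A *v x\<close>.\<close>

lemma psd_matrix_scaled_projection:
  fixes A :: "real^'n^'n"
  assumes sym: "transpose A = A" and idem: "A ** A = c *\<^sub>R A" and c: "c > 0"
  shows "psd_matrix A"
  unfolding psd_matrix_def
proof (intro conjI allI sym)
  fix x :: "real^'n"
  have "c * (x \<bullet> (A *v x)) = x \<bullet> (A *v (A *v x))"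
    by (simp add: matrix_vector_mul_assoc idem flip: scaleR_matrix_vector_assoc)
  also have "\<dots> = (A *v x) \<bullet> (A *v x)"
    by (metis dot_lmul_matrix sym vector_transpose_matrix)
  finally have "0 \<le> c * (x \<bullet> (A *v x))" by simp
  then show "0 \<le> x \<bullet> (A *v x)" using c by (simp add: zero_le_mult_iff)
qed

text \<open>With \<open>A = c P\<close> for an orthogonal projection \<open>P\<close>, the root is
  \<open>sqrt c P\<close>. The definite description also requires uniqueness: a positive
  semidefinite root \<open>B\<close> satisfies \<open>B^3 = c B\<close>, and positivity excludes the
  eigenvalue \<open>- sqrt c\<close>, which leaves \<open>B^2 = sqrt c B\<close>.\<close>

lemma psd_sqrt_scaled_projection:
  fixes A :: "real^'n^'n"
  assumes sym: "transpose A = A" and idem: "A ** A = c *\<^sub>R A" and c: "c > 0"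
  shows "psd_sqrt A = (1 / sqrt c) *\<^sub>R A"
  unfolding psd_sqrt_def
proof (rule the_equality)
  let ?B = "(1 / sqrt c) *\<^sub>R A"
  have tA: "transpose A = A" and pA: "\<And>x. 0 \<le> x \<bullet> (A *v x)"
    using psd_matrix_scaled_projection[OF assms] by (auto simp: psd_matrix_def)
  have "psd_matrix ?B"
    using tA pA c by (auto simp: psd_matrix_def transpose_scalar scaleR_matrix_vector_assoc[symmetric])
  moreover have "?B ** ?B = A"
    using c idem by (simp add: scalar_matrix_assoc matrix_scalar_ac flip: scalar_matrix_assoc)
  ultimately show "psd_matrix ?B \<and> ?B ** ?B = A" by simp
next
  fix B :: "real^'n^'n"
  assume B: "psd_matrix B \<and> B ** B = A"
  define s where "s = sqrt c"
  have s: "s > 0" "s * s = c" using c by (auto simp: s_def)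
  have tB: "transpose B = B" and pB: "\<And>x. 0 \<le> x \<bullet> (B *v x)"
    using B by (auto simp: psd_matrix_def)
  have adj: "(B *v x) \<bullet> y = x \<bullet> (B *v y)" for x y
    by (metis dot_lmul_matrix tB vector_transpose_matrix)
  \<comment> \<open>By symmetry of \<open>B\<close>, the squared norm of \<open>B x\<close> is the
    inner product of \<open>x\<close> with \<open>B (B x)\<close>.\<close>
  have inj: "B *v x = 0" if "B *v (B *v x) = 0" for x
    using that adj[of x "B *v x"] by simp
  have "A *v x = s *\<^sub>R (B *v x)" for x
  proof -
    have Ax: "A *v x = B *v (B *v x)" for x
      using B by (auto simp: matrix_vector_mul_assoc)
    have "A *v (A *v x) = c *\<^sub>R (A *v x)"
      using idem by (simp add: matrix_vector_mul_assoc scaleR_matrix_vector_assoc)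
    \<comment> \<open>This is \<open>B^4 = c B^2\<close>; one factor \<open>B\<close> is then
      cancelled through \<open>inj\<close>.\<close>
    then have "B *v (B *v (B *v (B *v x) - c *\<^sub>R x)) = 0"
      unfolding Ax by (simp add: matrix_vector_mult_diff_distrib matrix_vector_mult_scaleR)
    then have "B *v (B *v (B *v x) - c *\<^sub>R x) = 0" by (rule inj)
    then have cubic: "B *v (B *v (B *v x)) = c *\<^sub>R (B *v x)"
      by (simp add: matrix_vector_mult_diff_distrib matrix_vector_mult_scaleR)
    \<comment> \<open>If nonzero, \<open>y\<close> would be an eigenvector of \<open>B\<close> with
      the negative eigenvalue \<open>- s\<close>.\<close>
    define y where "y = B *v (B *v x) - s *\<^sub>R (B *v x)"
    have "B *v y = - s *\<^sub>R y"
      using s unfolding y_def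
      by (simp add: matrix_vector_mult_diff_distrib matrix_vector_mult_scaleR cubic scaleR_diff_right)
    then have "0 \<le> - s * (y \<bullet> y)" using pB[of y] by simp
    then have "y \<bullet> y \<le> 0" using s(1) by (simp add: mult_le_0_iff)
    then have "y = 0" by (metis inner_ge_zero inner_eq_zero_iff antisym)
    then show ?thesis by (simp add: y_def Ax)
  qed
  then have "A = s *\<^sub>R B"
    by (simp add: matrix_eq scaleR_matrix_vector_assoc[symmetric])
  then show "B = (1 / sqrt c) *\<^sub>R A"
    using s by (simp add: s_def)
qed

section \<open>Rotations and coordinates of the Gaussian measure\<close>

lemma orthogonal_transformation_measurable:
  fixes T :: "real^'n \<Rightarrow> real^'n"
  assumes "orthogonal_transformation T"
  shows "T \<in> borel \<rightarrow>\<^sub>M borel"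
  using assms by (intro borel_measurable_continuous_onI linear_continuous_on)
    (simp add: linear_conv_bounded_linear[symmetric] orthogonal_transformation_linear)

lemma borel_measurable_vec_nth_real [measurable]: "(\<lambda>z::real^'n. z $ i) \<in> borel \<rightarrow>\<^sub>M borel"
  by (intro borel_measurable_continuous_onI continuous_intros)

text \<open>Lebesgue measure is determined by its values on boxes, and the preimage of a box is its
  image under the inverse, again an orthogonal map, which preserves volume.\<close>

lemma distr_lborel_orthogonal:
  fixes f :: "real^'n::{finite,wellorder} \<Rightarrow> real^'n::_"
  assumes f: "orthogonal_transformation f"
  shows "distr lborel borel f = lborel"
proof (rule lborel_eqI[symmetric])
  fix l u :: "real^'n::_"
  assume lu: "\<And>b. b \<in> Basis \<Longrightarrow> l \<bullet> b \<le> u \<bullet> b"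
  have meas [measurable]: "f \<in> borel \<rightarrow>\<^sub>M borel"
    using f by (rule orthogonal_transformation_measurable)
  have bij: "bij f" using f by (rule orthogonal_transformation_bij)
  have inv: "orthogonal_transformation (inv f)" using f by (rule orthogonal_transformation_inv)
  have eq: "f -` box l u = inv f ` box l u" using bij by (simp add: bij_vimage_eq_inv_image)
  have fin: "inv f ` box l u \<in> lmeasurable"
    using measurable_orthogonal_image[OF inv] by simp
  have "emeasure (distr lborel borel f) (box l u) = emeasure lborel (f -` box l u)"
    by (subst emeasure_distr) auto
  also have "\<dots> = emeasure lebesgue (f -` box l u)"
    using measurable_sets[OF meas, of "box l u"] by simp
  also have "\<dots> = measure lebesgue (inv f ` box l u)"
    unfolding eq using fin by (rule emeasure_eq_measure2)
  also have "\<dots> = measure lebesgue (box l u)"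
    using measure_orthogonal_image[OF inv, of "box l u"] by simp
  also have "\<dots> = (\<Prod>b\<in>Basis. (u - l) \<bullet> b)"
    using lu by (simp add: measure_lborel_box_eq)
  finally show "emeasure (distr lborel borel f) (box l u) = ennreal (\<Prod>b\<in>Basis. (u - l) \<bullet> b)" .
qed simp

text \<open>The density depends on the norm alone, which is the source of the rotation
  invariance.\<close>

lemma std_gaussian_density_norm:
  fixes z :: "real^'n"
  shows "(\<Prod>i\<in>UNIV. std_normal_density (z $ i))
    = (1 / sqrt (2 * pi)) ^ CARD('n) * exp (- (norm z)\<^sup>2 / 2)"
proof -
  have "(\<Sum>i\<in>UNIV. - (z $ i)\<^sup>2 / 2) = - (norm z)\<^sup>2 / 2"
    by (simp add: norm_vec_def L2_set_def sum_nonneg sum_negf sum_divide_distrib)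
  then show ?thesis
    by (simp add: std_normal_density_def prod.distrib prod_dividef power_divide flip: exp_sum)
qed

lemma space_std_gaussian [simp]: "space std_gaussian = UNIV"
  and sets_std_gaussian [simp, measurable_cong]: "sets std_gaussian = sets borel"
  by (simp_all add: std_gaussian_def)

lemma nn_integral_std_gaussian_orthogonal:
  fixes T :: "real^'n::{finite,wellorder} \<Rightarrow> real^'n::_"
  assumes T: "orthogonal_transformation T" and f [measurable]: "f \<in> borel_measurable borel"
  shows "(\<integral>\<^sup>+z. f (T z) \<partial>std_gaussian) = (\<integral>\<^sup>+z. f z \<partial>std_gaussian)"
proof -
  have [measurable]: "T \<in> borel \<rightarrow>\<^sub>M borel"
    using T by (rule orthogonal_transformation_measurable)
  define d where "d r = ennreal ((1 / sqrt (2 * pi)) ^ CARD('n) * exp (- r\<^sup>2 / 2))" for r :: real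
  have [measurable]: "d \<in> borel_measurable borel" unfolding d_def by measurable
  have G: "std_gaussian = density lborel (\<lambda>z::real^'n::_. d (norm z))"
    unfolding std_gaussian_def std_gaussian_density_norm d_def ..
  have "(\<integral>\<^sup>+z. f (T z) \<partial>std_gaussian) = (\<integral>\<^sup>+z. d (norm (T z)) * f (T z) \<partial>lborel)"
    unfolding G using T by (subst nn_integral_density) (auto simp: orthogonal_transformation_norm)
  also have "\<dots> = (\<integral>\<^sup>+z. d (norm z) * f z \<partial>distr lborel borel T)"
    by (subst nn_integral_distr) auto
  also have "\<dots> = (\<integral>\<^sup>+z. f z \<partial>std_gaussian)"
    unfolding G distr_lborel_orthogonal[OF T] by (subst nn_integral_density) auto
  finally show ?thesis .
qed

abbreviation std_normal :: "real measure" where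
  "std_normal \<equiv> density lborel (\<lambda>x. ennreal (std_normal_density x))"

interpretation std_normal: prob_space std_normal
  by (rule prob_space_normal_density) simp

section \<open>Coordinates as independent standard normals\<close>

text \<open>On a product of sets the density and the indicator both factor over the coordinates, so
  the Lebesgue integral becomes a product of one-dimensional ones.\<close>

lemma distr_std_gaussian_PiM:
  "distr std_gaussian (PiM UNIV (\<lambda>_. std_normal)) (\<lambda>z i. z $ i) = PiM (UNIV :: 'n::finite set) (\<lambda>_. std_normal)"
proof -
  interpret product_sigma_finite "\<lambda>_::'n. std_normal" ..
  have m [measurable]: "(\<lambda>z i. z $ i) \<in> std_gaussian \<rightarrow>\<^sub>M PiM (UNIV::'n set) (\<lambda>_. std_normal)"
    by (rule measurable_PiM_single') auto
  show ?thesis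
  proof (rule PiM_eqI)
    fix A :: "'n \<Rightarrow> real set" assume A: "\<And>i. i \<in> UNIV \<Longrightarrow> A i \<in> sets std_normal"
    then have [measurable]: "A i \<in> sets borel" for i by simp
    \<comment> \<open>The product formula for \<open>lborel\<close> runs over basis vectors, so the
      coordinate \<open>i\<close> is recovered from \<open>axis i 1\<close>.\<close>
    define g where "g b = (let i = (THE i. b = axis i 1) in (\<lambda>x. ennreal (std_normal_density x) * indicator (A i) x))"
      for b :: "real^'n"
    have gax: "g (axis i 1) = (\<lambda>x. ennreal (std_normal_density x) * indicator (A i) x)" for i
      by (simp add: g_def Let_def axis_eq_axis)
    have B: "(Basis :: (real^'n) set) = (\<lambda>i. axis i 1) ` UNIV"
      by (auto simp: Basis_vec_def)
    have inj: "inj (\<lambda>i::'n. axis i (1::real))" by (auto simp: inj_on_def axis_eq_axis)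
    have "emeasure (distr std_gaussian (PiM UNIV (\<lambda>_. std_normal)) (\<lambda>z i. z $ i)) (PiE UNIV A)
        = emeasure std_gaussian {z. \<forall>i. z $ i \<in> A i}"
      by (subst emeasure_distr) (auto intro!: arg_cong[where f="emeasure _"] sets_PiM_I_finite)
    also have "\<dots> = (\<integral>\<^sup>+z. (\<Prod>b\<in>Basis. g b (z \<bullet> b)) \<partial>lborel)"
      unfolding std_gaussian_def
    proof (subst emeasure_density)
      show "(\<integral>\<^sup>+ z. ennreal (\<Prod>i\<in>UNIV. std_normal_density (z $ i)) * indicator {z. \<forall>i. z $ i \<in> A i} z \<partial>lborel)
        = (\<integral>\<^sup>+z. (\<Prod>b\<in>Basis. g b (z \<bullet> b)) \<partial>lborel)"
      proof (rule nn_integral_cong)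
        fix z :: "real^'n"
        have "(\<Prod>b\<in>Basis. g b (z \<bullet> b)) = (\<Prod>i\<in>UNIV. ennreal (std_normal_density (z $ i)) * indicator (A i) (z $ i))"
          unfolding B by (subst prod.reindex[OF inj]) (simp add: gax inner_axis)
        also have "\<dots> = ennreal (\<Prod>i\<in>UNIV. std_normal_density (z $ i)) * (\<Prod>i\<in>UNIV. indicator (A i) (z $ i))"
          by (simp add: prod.distrib prod_ennreal)
        also have "(\<Prod>i\<in>UNIV. indicator (A i) (z $ i)) = (indicator {z. \<forall>i. z $ i \<in> A i} z :: ennreal)"
          by (auto simp: indicator_def)
        finally show "ennreal (\<Prod>i\<in>UNIV. std_normal_density (z $ i)) * indicator {z. \<forall>i. z $ i \<in> A i} z
          = (\<Prod>b\<in>Basis. g b (z \<bullet> b))" by simp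
      qed
    qed auto
    also have "\<dots> = (\<Prod>b\<in>Basis. \<integral>\<^sup>+x. g b x \<partial>lborel)"
      by (rule nn_integral_lborel_prod) (auto simp: B gax)
    also have "\<dots> = (\<Prod>i\<in>UNIV. emeasure std_normal (A i))"
      unfolding B by (subst prod.reindex[OF inj]) (simp add: gax emeasure_density)
    finally show "emeasure (distr std_gaussian (PiM UNIV (\<lambda>_. std_normal)) (\<lambda>z i. z $ i)) (PiE UNIV A)
        = (\<Prod>i\<in>UNIV. emeasure std_normal (A i))" .
  qed auto
qed

lemma borel_measurable_vec_lambda:
  "(\<lambda>x. \<chi> i. x i) \<in> PiM (UNIV :: 'n::finite set) (\<lambda>_. borel) \<rightarrow>\<^sub>M (borel :: (real^'n) measure)"
proof (rule borel_measurable_euclidean_space[THEN iffD2], rule ballI)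
  fix b :: "real^'n" assume "b \<in> Basis"
  then obtain i where "b = axis i 1" by (auto simp: Basis_vec_def)
  then show "(\<lambda>x. (\<chi> i. x i) \<bullet> b) \<in> PiM (UNIV :: 'n set) (\<lambda>_. borel) \<rightarrow>\<^sub>M borel"
    by (simp add: inner_axis)
qed

lemma nn_integral_std_gaussian_PiM:
  fixes f :: "real^'n \<Rightarrow> ennreal"
  assumes [measurable]: "f \<in> borel_measurable borel"
  shows "(\<integral>\<^sup>+z. f z \<partial>std_gaussian) = (\<integral>\<^sup>+x. f (\<chi> i. x i) \<partial>PiM UNIV (\<lambda>_. std_normal))"
proof -
  have m [measurable]: "(\<lambda>z i. z $ i) \<in> std_gaussian \<rightarrow>\<^sub>M PiM (UNIV::'n set) (\<lambda>_. std_normal)"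
    by (rule measurable_PiM_single') auto
  have s: "sets (PiM (UNIV::'n set) (\<lambda>_. std_normal)) = sets (PiM (UNIV::'n set) (\<lambda>_. borel))"
    by (intro sets_PiM_cong) auto
  have [measurable]: "(\<lambda>x. \<chi> i. x i) \<in> PiM (UNIV::'n set) (\<lambda>_. std_normal) \<rightarrow>\<^sub>M borel"
    using borel_measurable_vec_lambda by (simp cong: measurable_cong_sets add: measurable_cong_sets[OF s refl])
  have "(\<integral>\<^sup>+x. f (\<chi> i. x i) \<partial>PiM UNIV (\<lambda>_. std_normal)) =
    (\<integral>\<^sup>+x. f (\<chi> i. x i) \<partial>distr std_gaussian (PiM UNIV (\<lambda>_. std_normal)) (\<lambda>z i. z $ i))"
    by (simp add: distr_std_gaussian_PiM)
  also have "\<dots> = (\<integral>\<^sup>+z. f z \<partial>std_gaussian)"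
    by (subst nn_integral_distr) auto
  finally show ?thesis ..
qed

text \<open>The integrand sees three coordinates only: the product measure is projected onto these,
  and they are then split off one at a time.\<close>

lemma nn_integral_std_gaussian_3:
  fixes f :: "real \<Rightarrow> real \<Rightarrow> real \<Rightarrow> ennreal" and i j k :: "'n::finite"
  assumes dist: "distinct [i, j, k]"
    and f: "(\<lambda>(a, b, c). f a b c) \<in> borel_measurable (borel \<Otimes>\<^sub>M borel \<Otimes>\<^sub>M borel)"
  shows "(\<integral>\<^sup>+z. f (z $ i) (z $ j) (z $ k) \<partial>std_gaussian) = (\<integral>\<^sup>+a. \<integral>\<^sup>+b. \<integral>\<^sup>+c. f a b c \<partial>std_normal \<partial>std_normal \<partial>std_normal)"
proof -
  interpret product_prob_space "\<lambda>_::'n. std_normal" UNIV ..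
  let ?J = "{i, j, k}"
  have fm: "(\<lambda>x. f (u x) (v x) (w x)) \<in> borel_measurable M"
    if "u \<in> M \<rightarrow>\<^sub>M borel" "v \<in> M \<rightarrow>\<^sub>M borel" "w \<in> M \<rightarrow>\<^sub>M borel" for u v w and M :: "'z measure"
    using measurable_compose[OF _ f, of "\<lambda>x. (u x, v x, w x)" M] that by simp
  have comp: "(\<lambda>x. x l) \<in> PiM A (\<lambda>_. std_normal) \<rightarrow>\<^sub>M borel" if "l \<in> A" for l :: 'n and A
    using measurable_component_singleton[OF that, of "\<lambda>_. std_normal"] by simp
  have "(\<integral>\<^sup>+z. f (z $ i) (z $ j) (z $ k) \<partial>std_gaussian) = (\<integral>\<^sup>+x. f (x i) (x j) (x k) \<partial>PiM UNIV (\<lambda>_. std_normal))"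
    by (subst nn_integral_std_gaussian_PiM) (auto intro!: fm)
  also have "\<dots> = (\<integral>\<^sup>+x. f (x i) (x j) (x k) \<partial>PiM ?J (\<lambda>_. std_normal))"
    by (subst distr_PiM_restrict_finite[symmetric, of ?J], simp, simp, subst nn_integral_distr)
      (auto intro!: fm comp)
  also have "\<dots> = (\<integral>\<^sup>+a. \<integral>\<^sup>+x. f a (x j) (x k) \<partial>PiM {j, k} (\<lambda>_. std_normal) \<partial>std_normal)"
    using dist by (subst product_nn_integral_insert_rev) (auto intro!: fm comp)
  also have "\<dots> = (\<integral>\<^sup>+a. \<integral>\<^sup>+b. \<integral>\<^sup>+x. f a b (x k) \<partial>PiM {k} (\<lambda>_. std_normal) \<partial>std_normal \<partial>std_normal)"
    using dist by (subst product_nn_integral_insert_rev) (auto intro!: fm comp)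
  also have "\<dots> = (\<integral>\<^sup>+a. \<integral>\<^sup>+b. \<integral>\<^sup>+c. f a b c \<partial>std_normal \<partial>std_normal \<partial>std_normal)"
    by (subst product_nn_integral_singleton) (auto intro!: fm)
  finally show ?thesis .
qed

section \<open>Gaussian integrals\<close>

lemma nn_integral_even:
  fixes f :: "real \<Rightarrow> ennreal"
  assumes [measurable]: "f \<in> borel_measurable borel" and even: "\<And>x. f (- x) = f x"
  shows "(\<integral>\<^sup>+x. f x \<partial>lborel) = 2 * (\<integral>\<^sup>+x. f x * indicator {0..} x \<partial>lborel)"
proof -
  have "(\<integral>\<^sup>+x. f x \<partial>lborel) = (\<integral>\<^sup>+x. f x * indicator {0..} x + f x * indicator {..0} x \<partial>lborel)"
    using AE_lborel_singleton[of "0::real"]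
    \<comment> \<open>The two closed half-lines share the point 0, which is a null set.\<close>
    by (intro nn_integral_cong_AE) (auto split: split_indicator)
  also have "\<dots> = (\<integral>\<^sup>+x. f x * indicator {0..} x \<partial>lborel) + (\<integral>\<^sup>+x. f x * indicator {..0} x \<partial>lborel)"
    by (rule nn_integral_add) auto
  also have "(\<integral>\<^sup>+x. f x * indicator {..0} x \<partial>lborel) = (\<integral>\<^sup>+x. f x * indicator {0..} x \<partial>lborel)"
    by (subst nn_integral_real_affine[where c="-1" and t=0])
      (auto simp: even intro!: nn_integral_cong split: split_indicator)
  finally show ?thesis by (simp add: mult_2)
qed

lemma nn_integral_std_normal:
  "f \<in> borel_measurable borel \<Longrightarrow>
    (\<integral>\<^sup>+x. f x \<partial>std_normal) = (\<integral>\<^sup>+x. ennreal (std_normal_density x) * f x \<partial>lborel)"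
  by (subst nn_integral_density) auto

lemma nn_integral_std_normal_square: "(\<integral>\<^sup>+x. ennreal (x\<^sup>2) \<partial>std_normal) = 1"
proof -
  have "(\<integral>\<^sup>+x. ennreal (std_normal_density x * x\<^sup>2) \<partial>lborel) = ennreal 1"
    using std_normal_moment_even[of 1]
    by (intro nn_integral_eq_integral[THEN trans]) (auto simp: has_bochner_integral_iff)
  then show ?thesis by (simp add: nn_integral_std_normal ennreal_mult)
qed

lemma nn_integral_std_normal_abs: "(\<integral>\<^sup>+x. ennreal \<bar>x\<bar> \<partial>std_normal) = ennreal (sqrt (2 / pi))"
proof -
  have "(\<integral>\<^sup>+x. ennreal (std_normal_density x * \<bar>x\<bar>) \<partial>lborel) = ennreal (sqrt (2 / pi))"
    using std_normal_moment_abs_odd[of 0]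
    by (intro nn_integral_eq_integral[THEN trans]) (auto simp: has_bochner_integral_iff)
  then show ?thesis by (simp add: nn_integral_std_normal ennreal_mult)
qed

text \<open>By symmetry this is twice an integral over \<open>{0..r}\<close>, where
  \<open>- std_normal_density\<close> is an antiderivative of
  \<open>x * std_normal_density x\<close>.\<close>

lemma nn_integral_std_normal_abs_truncated:
  assumes "0 \<le> r"
  shows "(\<integral>\<^sup>+x. ennreal \<bar>x\<bar> * indicator {x. \<bar>x\<bar> < r} x \<partial>std_normal) = ennreal (sqrt (2 / pi) * (1 - exp (- r\<^sup>2 / 2)))"
proof -
  have "(\<integral>\<^sup>+x. ennreal \<bar>x\<bar> * indicator {x. \<bar>x\<bar> < r} x \<partial>std_normal)
    = 2 * (\<integral>\<^sup>+x. ennreal (std_normal_density x) * (ennreal \<bar>x\<bar> * indicator {x. \<bar>x\<bar> < r} x) * indicator {0..} x \<partial>lborel)"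
    by (subst nn_integral_std_normal, measurable, subst nn_integral_even)
      (auto simp: std_normal_density_def split: split_indicator)
  also have "(\<integral>\<^sup>+x. ennreal (std_normal_density x) * (ennreal \<bar>x\<bar> * indicator {x. \<bar>x\<bar> < r} x) * indicator {0..} x \<partial>lborel)
    = (\<integral>\<^sup>+x. ennreal (std_normal_density x * x) * indicator {0..r} x \<partial>lborel)"
    using AE_lborel_singleton[of r]
    by (intro nn_integral_cong_AE) (auto simp: ennreal_mult split: split_indicator)
  also have "\<dots> = ennreal (- std_normal_density r - (- std_normal_density 0))"
  proof (rule nn_integral_FTC_Icc)
    have "((\<lambda>x. - (c * exp (- x\<^sup>2 / 2))) has_real_derivative c * exp (- x\<^sup>2 / 2) * x) (at x)" for c x :: real
      by (auto intro!: derivative_eq_intros)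
    then show "((\<lambda>x. - std_normal_density x) has_real_derivative std_normal_density x * x) (at x)" for x
      unfolding std_normal_density_def .
  qed (use assms in auto)
  also have "2 * \<dots> = ennreal (2 * (- std_normal_density r - (- std_normal_density 0)))"
    by (subst ennreal_mult') auto
  also have "2 * (- std_normal_density r - (- std_normal_density 0)) = sqrt (2 / pi) * (1 - exp (- r\<^sup>2 / 2))"
    by (simp add: std_normal_density_def real_sqrt_mult real_sqrt_divide field_simps)
  finally show ?thesis .
qed

text \<open>The integrand is \<open>1 / sqrt (1 + a)\<close> times the centered normal density of
  variance \<open>1 / (1 + a)\<close>.\<close>

lemma has_bochner_integral_normal_exp:
  assumes "0 \<le> a"
  shows "has_bochner_integral lborel (\<lambda>x. std_normal_density x * exp (- a * x\<^sup>2 / 2)) (1 / sqrt (1 + a))"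
proof -
  have "has_bochner_integral lborel (\<lambda>x. (1 / sqrt (1 + a)) * normal_density 0 (1 / sqrt (1 + a)) x) (1 / sqrt (1 + a) * 1)"
    using assms by (intro has_bochner_integral_mult_right) (simp add: has_bochner_integral_iff)
  moreover have "(1 / sqrt (1 + a)) * normal_density 0 (1 / sqrt (1 + a)) x = std_normal_density x * exp (- a * x\<^sup>2 / 2)" for x
    using assms by (simp add: normal_density_def power_divide real_sqrt_mult real_sqrt_divide field_simps flip: exp_add)
  ultimately show ?thesis by simp
qed

text \<open>Given a coordinate \<open>x\<close>, the squared mean is the conditional expectation of
  the product of two other absolute coordinates, both restricted to lie below
  \<open>\<bar>x\<bar>\<close>. Expanding the square gives Gaussian integrals with
  \<open>a = 0, 1, 2\<close>.\<close>

lemma nn_integral_std_normal_truncated_square: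
  "(\<integral>\<^sup>+x. (ennreal (sqrt (2 / pi) * (1 - exp (- x\<^sup>2 / 2))))\<^sup>2 \<partial>std_normal) = ennreal (2 / pi * (1 - sqrt 2 + 1 / sqrt 3))"
proof -
  have "has_bochner_integral lborel (\<lambda>x. 2 / pi * (std_normal_density x * exp (- 0 * x\<^sup>2 / 2)
      - 2 * (std_normal_density x * exp (- 1 * x\<^sup>2 / 2)) + std_normal_density x * exp (- 2 * x\<^sup>2 / 2)))
    (2 / pi * (1 / sqrt (1 + 0) - 2 * (1 / sqrt (1 + 1)) + 1 / sqrt (1 + 2)))"
    by (intro has_bochner_integral_mult_right has_bochner_integral_add has_bochner_integral_diff
        has_bochner_integral_normal_exp) auto
  moreover have "2 / pi * (std_normal_density x * exp (- 0 * x\<^sup>2 / 2)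
      - 2 * (std_normal_density x * exp (- 1 * x\<^sup>2 / 2)) + std_normal_density x * exp (- 2 * x\<^sup>2 / 2))
    = std_normal_density x * (sqrt (2 / pi) * (1 - exp (- x\<^sup>2 / 2)))\<^sup>2" for x
  proof -
    have "exp (- 2 * x\<^sup>2 / 2) = (exp (- x\<^sup>2 / 2))\<^sup>2"
      by (simp add: power2_eq_square flip: exp_add)
    moreover have "(sqrt (2 / pi) * (1 - exp (- x\<^sup>2 / 2)))\<^sup>2 = 2 / pi * (1 - 2 * exp (- x\<^sup>2 / 2) + (exp (- x\<^sup>2 / 2))\<^sup>2)"
      unfolding power_mult_distrib by (simp add: power2_diff)
    ultimately show ?thesis by (simp only:) (simp add: algebra_simps)
  qed
  moreover have "2 / sqrt 2 = sqrt 2" by (simp add: real_div_sqrt)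
  ultimately have *: "has_bochner_integral lborel (\<lambda>x. std_normal_density x * (sqrt (2 / pi) * (1 - exp (- x\<^sup>2 / 2)))\<^sup>2)
      (2 / pi * (1 - sqrt 2 + 1 / sqrt 3))" by simp
  have "(\<integral>\<^sup>+x. (ennreal (sqrt (2 / pi) * (1 - exp (- x\<^sup>2 / 2))))\<^sup>2 \<partial>std_normal) =
      (\<integral>\<^sup>+x. ennreal (std_normal_density x * (sqrt (2 / pi) * (1 - exp (- x\<^sup>2 / 2)))\<^sup>2) \<partial>lborel)"
    by (subst nn_integral_std_normal, measurable, subst ennreal_power, simp, subst ennreal_mult, auto)
  also have "\<dots> = ennreal (2 / pi * (1 - sqrt 2 + 1 / sqrt 3))"
    using * by (subst nn_integral_eq_integral) (auto simp: has_bochner_integral_iff)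
  finally show ?thesis .
qed

text \<open>The product of the two densities is \<open>C\<close> times a normal density of variance
  \<open>1 / (1 + s^2)\<close>, which leaves its third absolute moment.\<close>

lemma nn_integral_radial_cube:
  "(\<integral>\<^sup>+x. ennreal (std_normal_density x * std_normal_density (x * s) * \<bar>x\<bar> ^ 3) \<partial>lborel)
    = ennreal (2 / pi / (1 + s\<^sup>2)\<^sup>2)"
proof -
  define \<sigma> where "\<sigma> = 1 / sqrt (1 + s\<^sup>2)"
  have pos: "1 + s\<^sup>2 > 0" by (simp add: add_pos_nonneg)
  have \<sigma>: "\<sigma> > 0" "\<sigma>\<^sup>2 = 1 / (1 + s\<^sup>2)" using pos by (auto simp: \<sigma>_def power_divide)
  define C where "C = \<sigma> / sqrt (2 * pi)"
  have eq: "std_normal_density x * std_normal_density (x * s) * \<bar>x\<bar> ^ 3 = C * (normal_density 0 \<sigma> x * \<bar>x - 0\<bar> ^ (2 * 1 + 1))" for x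
  proof -
    have "exp (- x\<^sup>2 / 2) * exp (- (x * s)\<^sup>2 / 2) = exp (- x\<^sup>2 / (2 * \<sigma>\<^sup>2))"
      using pos by (simp add: \<sigma> power_mult_distrib field_simps flip: exp_add)
    moreover have "\<bar>x\<bar> ^ 3 = x * (x * \<bar>x\<bar>)"
      by (cases "0 \<le> x") (auto simp: power3_eq_cube)
    ultimately show ?thesis
      using \<sigma>(1) by (simp add: std_normal_density_def normal_density_def C_def real_sqrt_mult field_simps)
  qed
  have "has_bochner_integral lborel (\<lambda>x. std_normal_density x * std_normal_density (x * s) * \<bar>x\<bar> ^ 3)
     (C * (2^1 * \<sigma>^(2 * 1 + 1) * fact 1 * sqrt (2 / pi)))"
    unfolding eq by (intro has_bochner_integral_mult_right normal_moment_abs_odd \<sigma>)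
  also have "C * (2^1 * \<sigma>^(2 * 1 + 1) * fact 1 * sqrt (2 / pi)) = 2 / pi * (\<sigma>\<^sup>2)\<^sup>2"
    by (simp add: C_def real_sqrt_mult real_sqrt_divide field_simps power2_eq_square power3_eq_cube)
  also have "\<dots> = 2 / pi / (1 + s\<^sup>2)\<^sup>2" by (simp add: \<sigma> power_divide)
  finally show ?thesis
    by (subst nn_integral_eq_integral) (auto simp: has_bochner_integral_iff)
qed

text \<open>The substitution \<open>y = x * s\<close> turns the integral over \<open>x\<close> into a third absolute moment.\<close>
lemma nn_integral_std_normal_homogeneous:
  fixes g :: "real \<Rightarrow> real \<Rightarrow> real"
  assumes [measurable]: "(\<lambda>(x, y). g x y) \<in> borel_measurable (borel \<Otimes>\<^sub>M borel)"
    and nonneg: "\<And>x y. 0 \<le> g x y" and hom: "\<And>x s. g x (x * s) = x\<^sup>2 * g 1 s"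
  shows "(\<integral>\<^sup>+x. \<integral>\<^sup>+y. ennreal (g x y) \<partial>std_normal \<partial>std_normal) = (\<integral>\<^sup>+s. ennreal (2 / pi * (g 1 s / (1 + s\<^sup>2)\<^sup>2)) \<partial>lborel)"
proof -
  have rearrange: "ennreal a * (ennreal b * ennreal (c * (d * e))) = ennreal (a * c * (b * d)) * ennreal e"
    if "0 \<le> a" "0 \<le> b" "0 \<le> c" "0 \<le> d" "0 \<le> e" for a b c d e
    using that by (simp add: ennreal_mult mult_ac)
  have "(\<integral>\<^sup>+x. \<integral>\<^sup>+y. ennreal (g x y) \<partial>std_normal \<partial>std_normal)
     = (\<integral>\<^sup>+x. ennreal (std_normal_density x) * \<integral>\<^sup>+y. ennreal (std_normal_density y * g x y) \<partial>lborel \<partial>lborel)"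
    by (simp add: nn_integral_std_normal ennreal_mult nonneg)
  also have "\<dots> = (\<integral>\<^sup>+x. \<integral>\<^sup>+s. ennreal (std_normal_density x * std_normal_density (x * s) * \<bar>x\<bar> ^ 3) * ennreal (g 1 s) \<partial>lborel \<partial>lborel)"
  \<comment> \<open>The substitution \<open>y = x * s\<close> is valid off the null set
    \<open>x = 0\<close>. Its Jacobian \<open>\<bar>x\<bar>\<close> and the factor
    \<open>x^2\<close> from homogeneity give the cube.\<close>
  proof (rule nn_integral_cong_AE, rule AE_mp[OF AE_lborel_singleton[of "0::real"]], rule AE_I2, rule impI)
    fix x :: real assume x: "x \<noteq> 0"
    have cube: "\<bar>x\<bar> * x\<^sup>2 = \<bar>x\<bar> ^ 3"
      by (cases "0 \<le> x") (auto simp: power3_eq_cube power2_eq_square)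
    have subst: "(\<integral>\<^sup>+y. ennreal (std_normal_density y * g x y) \<partial>lborel)
      = (\<integral>\<^sup>+s. ennreal \<bar>x\<bar> * ennreal (std_normal_density (x * s) * (x\<^sup>2 * g 1 s)) \<partial>lborel)"
      using x by (subst nn_integral_real_affine[where t=0 and c=x]) (auto simp: hom nn_integral_cmult)
    show "ennreal (std_normal_density x) * (\<integral>\<^sup>+y. ennreal (std_normal_density y * g x y) \<partial>lborel)
      = (\<integral>\<^sup>+s. ennreal (std_normal_density x * std_normal_density (x * s) * \<bar>x\<bar> ^ 3) * ennreal (g 1 s) \<partial>lborel)"
      unfolding subst cube[symmetric]
      by (subst nn_integral_cmult[symmetric], measurable, intro nn_integral_cong rearrange) (auto simp: nonneg)
  qed
  \<comment> \<open>With \<open>x\<close> innermost, the slope \<open>s\<close> is a parameter and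
    the radial integral can be evaluated.\<close>
  also have "\<dots> = (\<integral>\<^sup>+s. \<integral>\<^sup>+x. ennreal (std_normal_density x * std_normal_density (x * s) * \<bar>x\<bar> ^ 3) * ennreal (g 1 s) \<partial>lborel \<partial>lborel)"
    by (rule lborel_pair.Fubini'[symmetric]) measurable
  also have "\<dots> = (\<integral>\<^sup>+s. ennreal (2 / pi / (1 + s\<^sup>2)\<^sup>2) * ennreal (g 1 s) \<partial>lborel)"
    by (subst nn_integral_multc) (auto simp: nn_integral_radial_cube)
  also have "\<dots> = (\<integral>\<^sup>+s. ennreal (2 / pi * (g 1 s / (1 + s\<^sup>2)\<^sup>2)) \<partial>lborel)"
    by (intro nn_integral_cong) (auto simp: nonneg mult_ac simp flip: ennreal_mult)
  finally show ?thesis .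
qed

section \<open>The cosine matrix\<close>

lemma matrix_4_eqI:
  fixes A B :: "real^4^4"
  assumes "A $ 1 $ 1 = B $ 1 $ 1" "A $ 1 $ 2 = B $ 1 $ 2" "A $ 1 $ 3 = B $ 1 $ 3" "A $ 1 $ 4 = B $ 1 $ 4"
   "A $ 2 $ 1 = B $ 2 $ 1" "A $ 2 $ 2 = B $ 2 $ 2" "A $ 2 $ 3 = B $ 2 $ 3" "A $ 2 $ 4 = B $ 2 $ 4"
   "A $ 3 $ 1 = B $ 3 $ 1" "A $ 3 $ 2 = B $ 3 $ 2" "A $ 3 $ 3 = B $ 3 $ 3" "A $ 3 $ 4 = B $ 3 $ 4"
   "A $ 4 $ 1 = B $ 4 $ 1" "A $ 4 $ 2 = B $ 4 $ 2" "A $ 4 $ 3 = B $ 4 $ 3" "A $ 4 $ 4 = B $ 4 $ 4"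
  shows "A = B"
  using assms by (simp add: vec_eq_iff forall_4)

definition mat4 :: "real list list \<Rightarrow> real^4^4" where
  "mat4 L = vector (map vector L)"

lemma mat4_nth [simp]:
  "mat4 [r1, r2, r3, r4] $ 1 = vector r1" "mat4 [r1, r2, r3, r4] $ 2 = vector r2"
  "mat4 [r1, r2, r3, r4] $ 3 = vector r3" "mat4 [r1, r2, r3, r4] $ 4 = vector r4"
  by (simp_all add: mat4_def vector_def)

lemma vector_4_nth [simp]:
  "(vector [a, b, c, d] :: real^4) $ 1 = a" "(vector [a, b, c, d] :: real^4) $ 2 = b"
  "(vector [a, b, c, d] :: real^4) $ 3 = c" "(vector [a, b, c, d] :: real^4) $ 4 = d"
  by (simp_all add: vector_def)

lemma Sigma_cos_entries:
  "Sigma_cos = mat4 [[1, sqrt 2 / 2, 0, - sqrt 2 / 2], [sqrt 2 / 2, 1, sqrt 2 / 2, 0],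
    [0, sqrt 2 / 2, 1, sqrt 2 / 2], [- sqrt 2 / 2, 0, sqrt 2 / 2, 1]]"
proof -
  have "cos (pi * 3 / 4) = - sqrt 2 / 2"
    using cos_pi_minus[of "pi / 4"] by (simp add: cos_45 field_simps)
  note c = this cos_45 cos_pi_half
  have i: "index_of 1 = 1" "index_of 2 = 2" "index_of 3 = 3" "index_of 4 = 4"
    using index_of_nat[of 1] index_of_nat[of 2] index_of_nat[of 3] index_of_nat[of 4] by auto
  have neg: "cos (- (x::real)) = cos x" for x by simp
  show ?thesis
    by (rule matrix_4_eqI) (use c neg[of "pi/4"] neg[of "pi * 3 / 4"] neg[of "pi/2"] in \<open>simp_all add: Sigma_cos_def i\<close>)
qed

text \<open>The terms are the distances of \<open>(x, y)\<close> to the lines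
  \<open>x + y = 0\<close>, \<open>y = 0\<close>, \<open>x = y\<close> and \<open>x = 0\<close>, in
  the order of the rows of \<open>Sigma_cos\<close>.\<close>

definition cosmin :: "real \<Rightarrow> real \<Rightarrow> real" where
  "cosmin x y = Min {\<bar>x + y\<bar> / sqrt 2, \<bar>y\<bar>, \<bar>x - y\<bar> / sqrt 2, \<bar>x\<bar>}"

lemma cosmin_measurable [measurable]: "(\<lambda>(x, y). cosmin x y) \<in> borel_measurable (borel \<Otimes>\<^sub>M borel)"
  unfolding cosmin_def by simp

lemma cosmin_nonneg: "0 \<le> cosmin x y"
  by (simp add: cosmin_def)

lemma cosmin_scale: "cosmin x (x * s) = \<bar>x\<bar> * cosmin 1 s"
proof -
  have "\<bar>x + x * s\<bar> = \<bar>x\<bar> * \<bar>1 + s\<bar>" "\<bar>x - x * s\<bar> = \<bar>x\<bar> * \<bar>1 - s\<bar>"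
    by (simp_all add: algebra_simps flip: abs_mult)
  then show ?thesis
    by (simp add: cosmin_def abs_mult min_mult_distrib_left)
qed

text \<open>By evenness in the slope it suffices to treat \<open>s \<ge> 0\<close>. Each of the
  three ranges bounds the minimum by one term, and the bounds \<open>h1\<close>, \<open>h2\<close>,
  \<open>h3\<close> have elementary antiderivatives.\<close>

lemma nn_integral_cosmin_planar:
  "(\<integral>\<^sup>+s. ennreal (2 / pi * ((cosmin 1 s)\<^sup>2 / (1 + s\<^sup>2)\<^sup>2)) \<partial>lborel) \<le> ennreal (1 - 2 * sqrt 2 / pi)"
proof -
  \<comment> \<open>\<open>t\<close> and \<open>u\<close> are the tangents of \<open>pi / 8\<close> and \<open>3 * pi / 8\<close>, where the smallest of the four terms changes.
    The arctangents in the three antiderivatives telescope, so their values at \<open>t\<close> and \<open>u\<close> are never needed.\<close>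
  define t u :: real where "t = sqrt 2 - 1" and "u = sqrt 2 + 1"
  have tu: "0 < t" "t < u" "0 < u" by (auto simp: t_def u_def add_pos_pos)
  have pos: "1 + s\<^sup>2 > 0" for s :: real by (simp add: add_pos_nonneg)
  have ne: "1 + s\<^sup>2 \<noteq> 0" for s :: real using pos[of s] by simp
  have ne2: "2 + s * (s * 2) \<noteq> 0" for s :: real
    using ne[of s] by (simp add: power2_eq_square)
  define h1 h2 h3 :: "real \<Rightarrow> real" where "h1 s = s\<^sup>2 / (1 + s\<^sup>2)\<^sup>2"
    and "h2 s = (1 - s)\<^sup>2 / 2 / (1 + s\<^sup>2)\<^sup>2" and "h3 s = 1 / (1 + s\<^sup>2)\<^sup>2" for s
  define F1 F2 F3 :: "real \<Rightarrow> real" where "F1 s = arctan s / 2 - s / (2 * (1 + s\<^sup>2))"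
    and "F2 s = arctan s / 2 + 1 / (2 * (1 + s\<^sup>2))"
    and "F3 s = arctan s / 2 + s / (2 * (1 + s\<^sup>2))" for s
  have [measurable]: "h1 \<in> borel_measurable borel" "h2 \<in> borel_measurable borel" "h3 \<in> borel_measurable borel"
    unfolding h1_def h2_def h3_def by measurable
  have nn: "0 \<le> h1 s" "0 \<le> h2 s" "0 \<le> h3 s" for s
    by (simp_all add: h1_def h2_def h3_def)
  have D: "(F1 has_real_derivative h1 s) (at s)" "(F2 has_real_derivative h2 s) (at s)"
    "(F3 has_real_derivative h3 s) (at s)" for s
    unfolding F1_def F2_def F3_def h1_def h2_def h3_def using ne[of s]
    by (auto intro!: derivative_eq_intros simp: ne) (simp_all add: ne divide_simps, simp_all add: power2_eq_square algebra_simps ne2)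
  have I1: "(\<integral>\<^sup>+s. ennreal (h1 s) * indicator {0..t} s \<partial>lborel) = ennreal (F1 t - F1 0)"
    using tu D nn by (intro nn_integral_FTC_Icc) auto
  have I2: "(\<integral>\<^sup>+s. ennreal (h2 s) * indicator {t..u} s \<partial>lborel) = ennreal (F2 u - F2 t)"
    using tu D nn by (intro nn_integral_FTC_Icc) auto
  have lim: "(F3 \<longlongrightarrow> pi / 4) at_top"
    unfolding F3_def by real_asymp
  have I3: "(\<integral>\<^sup>+s. ennreal (h3 s) * indicator {u..} s \<partial>lborel) = ennreal (pi / 4 - F3 u)"
    using D nn lim by (intro nn_integral_FTC_atLeast) auto
  have sq: "(cosmin 1 s)\<^sup>2 \<le> s\<^sup>2" "(cosmin 1 s)\<^sup>2 \<le> (1 - s)\<^sup>2 / 2" "(cosmin 1 s)\<^sup>2 \<le> 1" for s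
  proof -
    have "cosmin 1 s \<le> \<bar>s\<bar>" "cosmin 1 s \<le> \<bar>1 - s\<bar> / sqrt 2" "cosmin 1 s \<le> 1"
      unfolding cosmin_def by (rule Min_le; simp)+
    from this[THEN power_mono[OF _ cosmin_nonneg], of 2]
    show "(cosmin 1 s)\<^sup>2 \<le> s\<^sup>2" "(cosmin 1 s)\<^sup>2 \<le> (1 - s)\<^sup>2 / 2" "(cosmin 1 s)\<^sup>2 \<le> 1"
      by (simp_all add: power_divide)
  qed
  have le: "(cosmin 1 s)\<^sup>2 / (1 + s\<^sup>2)\<^sup>2 \<le> h1 s" "(cosmin 1 s)\<^sup>2 / (1 + s\<^sup>2)\<^sup>2 \<le> h2 s"
     "(cosmin 1 s)\<^sup>2 / (1 + s\<^sup>2)\<^sup>2 \<le> h3 s" for s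
    unfolding h1_def h2_def h3_def by (intro divide_right_mono sq; simp)+
  have even: "cosmin 1 (- s) = cosmin 1 s" for s
  proof -
    have "cosmin 1 (- s) = Min {\<bar>1 - s\<bar> / sqrt 2, \<bar>s\<bar>, \<bar>1 + s\<bar> / sqrt 2, \<bar>1\<bar>}"
      unfolding cosmin_def by (simp only: abs_minus_cancel minus_minus diff_minus_eq_add add_uminus_conv_diff)
    also have "{\<bar>1 - s\<bar> / sqrt 2, \<bar>s\<bar>, \<bar>1 + s\<bar> / sqrt 2, \<bar>1\<bar>}
      = {\<bar>1 + s\<bar> / sqrt 2, \<bar>s\<bar>, \<bar>1 - s\<bar> / sqrt 2, \<bar>1\<bar>}"
      by blast
    finally show ?thesis unfolding cosmin_def .
  qed
  have "(\<integral>\<^sup>+s. ennreal ((cosmin 1 s)\<^sup>2 / (1 + s\<^sup>2)\<^sup>2) \<partial>lborel)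
     = 2 * (\<integral>\<^sup>+s. ennreal ((cosmin 1 s)\<^sup>2 / (1 + s\<^sup>2)\<^sup>2) * indicator {0..} s \<partial>lborel)"
    by (rule nn_integral_even) (auto simp: even)
  \<comment> \<open>The closed ranges overlap at \<open>t\<close> and \<open>u\<close>, which can
    only enlarge the right-hand side.\<close>
  also have "(\<integral>\<^sup>+s. ennreal ((cosmin 1 s)\<^sup>2 / (1 + s\<^sup>2)\<^sup>2) * indicator {0..} s \<partial>lborel)
     \<le> (\<integral>\<^sup>+s. ennreal (h1 s) * indicator {0..t} s + (ennreal (h2 s) * indicator {t..u} s
           + ennreal (h3 s) * indicator {u..} s) \<partial>lborel)"
    using tu by (intro nn_integral_mono) (auto simp: le nn split: split_indicator intro!: ennreal_leI
      intro: add_increasing add_increasing2)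
  also have "\<dots> = ennreal (F1 t - F1 0) + (ennreal (F2 u - F2 t) + ennreal (pi / 4 - F3 u))"
    by (subst nn_integral_add, measurable, subst nn_integral_add) (auto simp: I1 I2 I3)
  also have "\<dots> = ennreal ((F1 t - F1 0) + ((F2 u - F2 t) + (pi / 4 - F3 u)))"
  proof -
    \<comment> \<open>Addition passes through \<open>ennreal\<close> for nonnegative increments;
      monotonicity supplies this without evaluating the arctangents.\<close>
    have "F1 0 \<le> F1 t"
      by (rule DERIV_nonneg_imp_nondecreasing) (use tu D(1) nn(1) in auto)
    moreover have "F2 t \<le> F2 u"
      by (rule DERIV_nonneg_imp_nondecreasing) (use tu D(2) nn(2) in auto)
    moreover have "F3 u \<le> pi / 4"
    proof (rule tendsto_lowerbound[OF lim])
      have "F3 u \<le> F3 s" if "u \<le> s" for s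
        by (rule DERIV_nonneg_imp_nondecreasing[OF that]) (use D(3) nn(3) in auto)
      then show "eventually (\<lambda>s. F3 u \<le> F3 s) at_top"
        unfolding eventually_at_top_linorder by blast
    qed simp
    ultimately show ?thesis by (simp add: ennreal_plus)
  qed
  also have "(F1 t - F1 0) + ((F2 u - F2 t) + (pi / 4 - F3 u)) = pi / 4 - sqrt 2 / 2"
  proof -
    \<comment> \<open>These identities turn the rational parts of the antiderivatives into multiples
      of \<open>1\<close>, \<open>1 / t\<close> and \<open>1 / u\<close>, and
      \<open>t * u = 1\<close> does the rest.\<close>
    have "1 + t\<^sup>2 = 2 * sqrt 2 * t" "1 + u\<^sup>2 = 2 * sqrt 2 * u"
      by (simp_all add: t_def u_def power2_eq_square algebra_simps)
    then have "F1 t - F1 0 + ((F2 u - F2 t) + (pi / 4 - F3 u))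
      = pi / 4 - t / (4 * sqrt 2 * t) + 1 / (4 * sqrt 2 * u) - 1 / (4 * sqrt 2 * t) - u / (4 * sqrt 2 * u)"
      by (simp add: F1_def F2_def F3_def)
    also have "\<dots> = pi / 4 - sqrt 2 / 4 + (1 / u - 1 / t) / (4 * sqrt 2)"
      using tu by (simp add: field_simps)
    also have "1 / u = t"
      using tu by (simp_all add: t_def u_def field_simps)
    also have "1 / t = u"
      using tu by (simp_all add: t_def u_def field_simps)
    also have "(t - u) / (4 * sqrt 2) = - sqrt 2 / 4"
      by (simp add: t_def u_def field_simps)
    finally show ?thesis by simp
  qed
  finally have "(\<integral>\<^sup>+s. ennreal ((cosmin 1 s)\<^sup>2 / (1 + s\<^sup>2)\<^sup>2) \<partial>lborel) \<le> 2 * ennreal (pi / 4 - sqrt 2 / 2)"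
    by (simp add: mult_left_mono)
  then have "ennreal (2 / pi) * (\<integral>\<^sup>+s. ennreal ((cosmin 1 s)\<^sup>2 / (1 + s\<^sup>2)\<^sup>2) \<partial>lborel)
     \<le> ennreal (2 / pi) * (2 * ennreal (pi / 4 - sqrt 2 / 2))"
    by (rule mult_left_mono) simp
  also have "\<dots> = ennreal (2 / pi * (2 * (pi / 4 - sqrt 2 / 2)))"
    by (subst ennreal_mult', simp, subst ennreal_mult', simp, simp only: ennreal_numeral)
  also have "2 / pi * (2 * (pi / 4 - sqrt 2 / 2)) = 1 - 2 * sqrt 2 / pi"
    by (simp add: field_simps)
  finally show ?thesis
    by (subst ennreal_mult') (auto simp: nn_integral_cmult)
qed

lemma nn_integral_cosmin:
  "(\<integral>\<^sup>+x. \<integral>\<^sup>+y. ennreal ((cosmin x y)\<^sup>2) \<partial>std_normal \<partial>std_normal) \<le> ennreal (1 - 2 * sqrt 2 / pi)"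
proof -
  have "(\<integral>\<^sup>+x. \<integral>\<^sup>+y. ennreal ((cosmin x y)\<^sup>2) \<partial>std_normal \<partial>std_normal)
    = (\<integral>\<^sup>+s. ennreal (2 / pi * ((cosmin 1 s)\<^sup>2 / (1 + s\<^sup>2)\<^sup>2)) \<partial>lborel)"
    by (rule nn_integral_std_normal_homogeneous) (auto simp: cosmin_scale power_mult_distrib)
  then show ?thesis using nn_integral_cosmin_planar by (simp only:)
qed

section \<open>The two matrices as scaled projections, and the rotation for the cosine
  matrix\<close>

lemma orthogonal_transformation_mult_matrix:
  fixes Q :: "real^'n^'n"
  assumes "transpose Q ** Q = mat 1"
  shows "orthogonal_transformation ((*v) Q)"
  using assms by (simp add: orthogonal_transformation_matrix orthogonal_matrix)

lemma Sigma_cos_transpose: "transpose Sigma_cos = Sigma_cos"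
  unfolding Sigma_cos_entries by (rule matrix_4_eqI) (simp_all add: transpose_def)

text \<open>\<open>Sigma_cos\<close> is the Gram matrix of four plane unit vectors at angles
  \<open>pi / 4\<close> apart. They form a tight frame with constant 2, so it is twice a projection
  of rank two.\<close>

lemma Sigma_cos_square: "Sigma_cos ** Sigma_cos = 2 *\<^sub>R Sigma_cos"
  unfolding Sigma_cos_entries by (rule matrix_4_eqI) (simp_all add: matrix_matrix_mult_def sum_4)

lemma Sigma_simplex_transpose: "transpose Sigma_simplex = Sigma_simplex"
  unfolding Sigma_simplex_def by (rule matrix_4_eqI) (simp_all add: transpose_def)

text \<open>\<open>Sigma_simplex\<close> is \<open>4 / 3\<close> times the projection onto the
  orthogonal complement of the all-ones vector.\<close>

lemma Sigma_simplex_square: "Sigma_simplex ** Sigma_simplex = (4 / 3) *\<^sub>R Sigma_simplex"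
  unfolding Sigma_simplex_def by (rule matrix_4_eqI) (simp_all add: matrix_matrix_mult_def sum_4)

text \<open>The first two rows span the range of \<open>Sigma_cos\<close>.\<close>
definition rot_cos :: "real^4^4" where
  "rot_cos = mat4 [[1 / 2, 0, - 1 / 2, - sqrt 2 / 2], [1 / 2, sqrt 2 / 2, 1 / 2, 0],
     [1 / 2, 0, - 1 / 2, sqrt 2 / 2], [1 / 2, - sqrt 2 / 2, 1 / 2, 0]]"

lemma orthogonal_rot_cos: "orthogonal_transformation ((*v) rot_cos)"
  by (rule orthogonal_transformation_mult_matrix, rule matrix_4_eqI)
    (simp_all add: rot_cos_def matrix_matrix_mult_def transpose_def mat_def sum_4)

text \<open>In the rotated coordinates the rows of the square root are plane unit vectors at the
  angles \<open>pi / 4\<close>, \<open>pi / 2\<close>, \<open>3 * pi / 4\<close> and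
  \<open>pi\<close>; absolute values remove the signs.\<close>

lemma min_abs_Sigma_cos:
  "min_abs Sigma_cos z = cosmin ((rot_cos *v z) $ 1) ((rot_cos *v z) $ 2)"
proof -
  have "psd_sqrt Sigma_cos = (1 / sqrt 2) *\<^sub>R Sigma_cos"
    using Sigma_cos_transpose Sigma_cos_square by (rule psd_sqrt_scaled_projection) simp
  then have nth: "(psd_sqrt Sigma_cos *v z) $ i = (Sigma_cos *v z) $ i / sqrt 2" for i
    by (simp add: scaleR_matrix_vector_assoc[symmetric])
  let ?x = "(rot_cos *v z) $ 1" and ?y = "(rot_cos *v z) $ 2"
  have "(Sigma_cos *v z) $ 1 / sqrt 2 = (?x + ?y) / sqrt 2"
    "(Sigma_cos *v z) $ 2 / sqrt 2 = ?y"
    "(Sigma_cos *v z) $ 3 / sqrt 2 = - ((?x - ?y) / sqrt 2)"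
    "(Sigma_cos *v z) $ 4 / sqrt 2 = - ?x"
    by (simp_all add: Sigma_cos_entries rot_cos_def matrix_vector_mult_def sum_4 field_simps)
  then show ?thesis
    unfolding min_abs_def cosmin_def nth UNIV_4 by (simp only: image_insert image_empty) simp
qed

text \<open>Both sides are 0 when the integral is infinite, so a lower bound drawn from this
  equation has to come with a proof of finiteness.\<close>

lemma integral_std_gaussian_orthogonal:
  fixes g :: "real^'n::{finite,wellorder} \<Rightarrow> real" and T :: "real^'n::_ \<Rightarrow> real^'n::_"
  assumes T: "orthogonal_transformation T" and [measurable]: "g \<in> borel_measurable borel"
    and nonneg: "\<And>z. 0 \<le> g z"
  shows "(\<integral>z. g (T z) \<partial>std_gaussian) = enn2real (\<integral>\<^sup>+z. ennreal (g z) \<partial>std_gaussian)"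
proof -
  have [measurable]: "T \<in> borel \<rightarrow>\<^sub>M borel"
    using T by (rule orthogonal_transformation_measurable)
  show ?thesis
    using nonneg by (subst integral_eq_nn_integral) (auto simp: nn_integral_std_gaussian_orthogonal[OF T, of "\<lambda>z. ennreal (g z)"])
qed

lemma integral_min_abs_Sigma_cos:
  "(\<integral>z. (min_abs Sigma_cos z)\<^sup>2 \<partial>std_gaussian) \<le> 1 - 2 * sqrt 2 / pi"
proof -
  have "(\<integral>\<^sup>+z. ennreal ((cosmin (z $ 1) (z $ (2::4)))\<^sup>2) \<partial>std_gaussian)
    = (\<integral>\<^sup>+x. \<integral>\<^sup>+y. \<integral>\<^sup>+u. ennreal ((cosmin x y)\<^sup>2) \<partial>std_normal \<partial>std_normal \<partial>std_normal)"
    \<comment> \<open>The third coordinate is a dummy variable, integrated out with total mass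
      1.\<close>
    by (rule nn_integral_std_gaussian_3[of 1 2 3 "\<lambda>x y u. ennreal ((cosmin x y)\<^sup>2)"]) simp_all
  also have "\<dots> \<le> ennreal (1 - 2 * sqrt 2 / pi)"
    using nn_integral_cosmin by (simp add: std_normal.emeasure_space_1[simplified])
  finally have "enn2real (\<integral>\<^sup>+z. ennreal ((cosmin (z $ 1) (z $ (2::4)))\<^sup>2) \<partial>std_gaussian) \<le> 1 - 2 * sqrt 2 / pi"
  proof (rule enn2real_leI[rotated])
    \<comment> \<open>This amounts to \<open>2 * sqrt 2 \<le> pi\<close>.\<close>
    have "sin (pi / 4) \<le> pi / 4" by (rule sin_x_le_x) simp
    then show "0 \<le> 1 - 2 * sqrt 2 / pi" by (simp add: sin_45)
  qed
  then show ?thesis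
    unfolding min_abs_Sigma_cos
    using integral_std_gaussian_orthogonal[OF orthogonal_rot_cos, of "\<lambda>z. (cosmin (z $ 1) (z $ 2))\<^sup>2"] by simp
qed

section \<open>The simplex matrix\<close>

definition simpmin :: "real \<Rightarrow> real \<Rightarrow> real \<Rightarrow> real" where
  "simpmin a b c = Min {\<bar>a + b + c\<bar>, \<bar>a - b - c\<bar>, \<bar>a - b + c\<bar>, \<bar>a + b - c\<bar>} / sqrt 3"

text \<open>The last row spans the kernel of \<open>Sigma_simplex\<close>.\<close>
definition rot_simplex :: "real^4^4" where
  "rot_simplex = (1 / 2) *\<^sub>R mat4 [[1, 1, - 1, - 1], [1, - 1, 1, - 1], [1, - 1, - 1, 1], [1, 1, 1, 1]]"

lemma orthogonal_rot_simplex: "orthogonal_transformation ((*v) rot_simplex)"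
  by (rule orthogonal_transformation_mult_matrix, rule matrix_4_eqI)
    (simp_all add: rot_simplex_def matrix_matrix_mult_def transpose_def mat_def sum_4)

text \<open>The root is \<open>sqrt 3 / 2\<close> times \<open>Sigma_simplex\<close>, whose rows
  applied to \<open>z\<close> give \<open>2 / 3\<close> times a signed sum of the rotated
  coordinates; together the factor is \<open>1 / sqrt 3\<close>.\<close>

lemma min_abs_Sigma_simplex:
  "min_abs Sigma_simplex z
    = simpmin ((rot_simplex *v z) $ 1) ((rot_simplex *v z) $ 2) ((rot_simplex *v z) $ 3)"
proof -
  have "psd_sqrt Sigma_simplex = (1 / sqrt (4 / 3)) *\<^sub>R Sigma_simplex"
    using Sigma_simplex_transpose Sigma_simplex_square by (rule psd_sqrt_scaled_projection) simp
  also have "1 / sqrt (4 / 3) = sqrt 3 / 2" by (simp add: real_sqrt_divide)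
  finally have nth: "(psd_sqrt Sigma_simplex *v z) $ i = (3 / 2 * (Sigma_simplex *v z) $ i) / sqrt 3" for i
    by (simp add: scaleR_matrix_vector_assoc[symmetric] field_simps)
  let ?a = "(rot_simplex *v z) $ 1" and ?b = "(rot_simplex *v z) $ 2" and ?c = "(rot_simplex *v z) $ 3"
  have "3 / 2 * (Sigma_simplex *v z) $ 1 = ?a + ?b + ?c"
    "3 / 2 * (Sigma_simplex *v z) $ 2 = ?a - ?b - ?c"
    "3 / 2 * (Sigma_simplex *v z) $ 3 = - (?a - ?b + ?c)"
    "3 / 2 * (Sigma_simplex *v z) $ 4 = - (?a + ?b - ?c)"
    by (simp_all add: Sigma_simplex_def rot_simplex_def matrix_vector_mult_def sum_4 field_simps)
  note abs = this[THEN arg_cong, of abs, unfolded abs_minus_cancel]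
  let ?S = "{\<bar>?a + ?b + ?c\<bar>, \<bar>?a - ?b - ?c\<bar>, \<bar>?a - ?b + ?c\<bar>, \<bar>?a + ?b - ?c\<bar>}"
  have range: "range (\<lambda>i. \<bar>(psd_sqrt Sigma_simplex *v z) $ i\<bar>) = (\<lambda>x. x / sqrt 3) ` ?S"
    unfolding nth UNIV_4 image_insert image_empty abs_divide abs by simp
  show ?thesis
    unfolding min_abs_def simpmin_def range
    by (rule mono_Min_commute[symmetric]) (auto intro!: monoI divide_right_mono)
qed

section \<open>Pointwise bounds for the simplex minimum\<close>

text \<open>\<open>clip r x * clip r y\<close> is the product of the absolute values of
  \<open>x\<close> and \<open>y\<close> if \<open>\<bar>r\<bar>\<close> strictly exceeds both, and 0
  otherwise. By strictness at most one of the three products formed from a triple is nonzero, so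
  their sum never exceeds the product of the two smaller absolute values.\<close>

definition clip :: "real \<Rightarrow> real \<Rightarrow> real" where
  "clip r x = (if \<bar>x\<bar> < \<bar>r\<bar> then \<bar>x\<bar> else 0)"

lemma clip_measurable [measurable]: "(\<lambda>(r, x). clip r x) \<in> borel_measurable (borel \<Otimes>\<^sub>M borel)"
  unfolding clip_def by measurable

lemma clip_nonneg: "0 \<le> clip r x" by (simp add: clip_def)

lemma simpmin_measurable [measurable]:
  "(\<lambda>(a, b, c). simpmin a b c) \<in> borel_measurable (borel \<Otimes>\<^sub>M borel \<Otimes>\<^sub>M borel)"
  unfolding simpmin_def by simp

text \<open>Expanding \<open>(u + v + w)^2\<close> leaves the pairwise products. One of them is
  nonnegative and, added to its absolute value, gives at least \<open>2 * K\<close>; each of the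
  others plus its absolute value is at least 0.\<close>

lemma simpmin_lower:
  "a\<^sup>2 + b\<^sup>2 + c\<^sup>2 + 4 * (clip a b * clip a c + clip b a * clip b c + clip c a * clip c b)
    \<le> 3 * (simpmin a b c)\<^sup>2 + 2 * (\<bar>a\<bar> * \<bar>b\<bar> + \<bar>a\<bar> * \<bar>c\<bar> + \<bar>b\<bar> * \<bar>c\<bar>)"
proof -
  let ?S = "{\<bar>a + b + c\<bar>, \<bar>a - b - c\<bar>, \<bar>a - b + c\<bar>, \<bar>a + b - c\<bar>}"
  define K where "K = clip a b * clip a c + clip b a * clip b c + clip c a * clip c b"
  define p q r where "p = \<bar>a\<bar>" "q = \<bar>b\<bar>" "r = \<bar>c\<bar>"
  have nn: "0 \<le> p" "0 \<le> q" "0 \<le> r" by (simp_all add: p_q_r_def)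
  have sq: "a\<^sup>2 = p\<^sup>2" "b\<^sup>2 = q\<^sup>2" "c\<^sup>2 = r\<^sup>2" by (simp_all add: p_q_r_def)
  have K: "K \<le> p * q" "K \<le> p * r" "K \<le> q * r"
    using nn mult_left_mono[of p q r] mult_left_mono[of q p r] mult_left_mono[of p r q]
      mult_left_mono[of r p q] mult_left_mono[of q r p] mult_left_mono[of r q p]
    by (auto simp: K_def clip_def mult_ac simp flip: p_q_r_def)
  have sign: "p\<^sup>2 + q\<^sup>2 + r\<^sup>2 + 4 * K \<le> (u + v + w)\<^sup>2 + 2 * (p * q + p * r + q * r)"
    if uvw: "\<bar>u\<bar> = p" "\<bar>v\<bar> = q" "\<bar>w\<bar> = r" for u v w
  proof -
    have abs: "\<bar>u * v\<bar> = p * q" "\<bar>u * w\<bar> = p * r" "\<bar>v * w\<bar> = q * r"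
      by (simp_all add: uvw abs_mult)
    \<comment> \<open>The product of \<open>u * v\<close>, \<open>u * w\<close> and \<open>v * w\<close> is a square.\<close>
    have "0 \<le> u * v \<or> 0 \<le> u * w \<or> 0 \<le> v * w"
      by (simp add: zero_le_mult_iff) linarith
    then have "2 * K \<le> (u * v + u * w + v * w) + (p * q + p * r + q * r)"
      using K abs[THEN eq_refl, THEN abs_le_D2] abs
      by (elim disjE) (simp_all add: abs_of_nonneg)
    from mult_left_mono[OF this, of 2]
    have "4 * K \<le> 2 * (u * v + u * w + v * w) + 2 * (p * q + p * r + q * r)"
      by (simp only: distrib_left) simp
    moreover have "(u + v + w)\<^sup>2 = p\<^sup>2 + q\<^sup>2 + r\<^sup>2 + 2 * (u * v + u * w + v * w)"
      unfolding uvw[symmetric] power2_abs by (simp add: power2_eq_square algebra_simps)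
    ultimately show ?thesis by simp
  qed
  define m where "m = Min ?S"
  have "m \<in> ?S" unfolding m_def by (rule Min_in) auto
  \<comment> \<open>The minimum is attained, and each member of \<open>?S\<close> is a signed sum of
    \<open>a\<close>, \<open>b\<close>, \<open>c\<close> in absolute value.\<close>
  then obtain u v w where uvw: "\<bar>u\<bar> = p" "\<bar>v\<bar> = q" "\<bar>w\<bar> = r" and m: "m = \<bar>u + v + w\<bar>"
    using that[of a b c] that[of a "- b" "- c"] that[of a "- b" c] that[of a b "- c"]
    by (auto simp: p_q_r_def)
  have "3 * (simpmin a b c)\<^sup>2 = (u + v + w)\<^sup>2"
    unfolding simpmin_def m_def[symmetric] by (simp add: power_divide m)
  then show ?thesis
    using sign[OF uvw] by (simp add: sq K_def flip: p_q_r_def)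
qed

text \<open>A crude Cauchy-Schwarz bound, used to show that the second moment is finite.\<close>

lemma simpmin_upper: "(simpmin a b c)\<^sup>2 \<le> a\<^sup>2 + b\<^sup>2 + c\<^sup>2"
proof -
  define m where "m = Min {\<bar>a + b + c\<bar>, \<bar>a - b - c\<bar>, \<bar>a - b + c\<bar>, \<bar>a + b - c\<bar>}"
  have "m \<le> \<bar>a + b + c\<bar>" "0 \<le> m" by (simp_all add: m_def)
  then have "m\<^sup>2 \<le> (a + b + c)\<^sup>2" by (metis power2_abs power_mono)
  also have "\<dots> \<le> 3 * (a\<^sup>2 + b\<^sup>2 + c\<^sup>2)"
    using sum_squares_ge_zero[of "a - b" "b - c"] zero_le_power2[of "a - c"]
    by (simp add: power2_eq_square algebra_simps)
  finally show ?thesis by (simp add: simpmin_def power_divide flip: m_def)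
qed

text \<open>The expectation of \<open>simpmin_lower\<close>: each square contributes 1, each
  absolute product \<open>2 / pi\<close> and each \<open>clip\<close> product
  \<open>\<kappa>\<close>.\<close>

lemma integral_min_abs_Sigma_simplex:
  "1 + 4 * (2 / pi * (1 - sqrt 2 + 1 / sqrt 3)) - 4 / pi \<le> (\<integral>z. (min_abs Sigma_simplex z)\<^sup>2 \<partial>std_gaussian)"
proof -
  define \<kappa> where "\<kappa> = 2 / pi * (1 - sqrt 2 + 1 / sqrt 3)"
  let ?E = "\<lambda>f. \<integral>\<^sup>+z. ennreal (f (z::real^4)) \<partial>std_gaussian"
  have [simp]: "emeasure std_normal UNIV = 1" using std_normal.emeasure_space_1 by simp
  have square: "?E (\<lambda>z. (z $ i)\<^sup>2) = 1" if "distinct [i, j, k]" for i j k :: 4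
    using nn_integral_std_gaussian_3[OF that, of "\<lambda>x y u. ennreal (x\<^sup>2)"]
    by (simp add: nn_integral_std_normal_square)
  have sqrt_sq: "ennreal (sqrt (2 / pi)) * ennreal (sqrt (2 / pi)) = ennreal (2 / pi)"
    by (subst ennreal_mult[symmetric]) (simp_all flip: power2_eq_square)
  have prod: "?E (\<lambda>z. \<bar>z $ i\<bar> * \<bar>z $ j\<bar>) = ennreal (2 / pi)" if "distinct [i, j, k]" for i j k :: 4
    using nn_integral_std_gaussian_3[OF that, of "\<lambda>x y u. ennreal (\<bar>x\<bar> * \<bar>y\<bar>)"]
    by (simp add: ennreal_mult nn_integral_cmult nn_integral_multc nn_integral_std_normal_abs sqrt_sq)
  have trunc: "(\<integral>\<^sup>+y. ennreal (clip x y) \<partial>std_normal) = ennreal (sqrt (2 / pi) * (1 - exp (- x\<^sup>2 / 2)))" for x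
  proof -
    have "(\<integral>\<^sup>+y. ennreal (clip x y) \<partial>std_normal) = (\<integral>\<^sup>+y. ennreal \<bar>y\<bar> * indicator {y. \<bar>y\<bar> < \<bar>x\<bar>} y \<partial>std_normal)"
      by (intro nn_integral_cong) (auto simp: clip_def split: split_indicator)
    then show ?thesis by (simp add: nn_integral_std_normal_abs_truncated)
  qed
  \<comment> \<open>Given coordinate \<open>i\<close>, the two clipped factors are independent with
    equal means, so the conditional expectation is a square.\<close>
  have tail: "?E (\<lambda>z. clip (z $ i) (z $ j) * clip (z $ i) (z $ k)) = ennreal \<kappa>" if "distinct [i, j, k]" for i j k :: 4
  proof -
    have "?E (\<lambda>z. clip (z $ i) (z $ j) * clip (z $ i) (z $ k))
      = (\<integral>\<^sup>+x. \<integral>\<^sup>+y. \<integral>\<^sup>+u. ennreal (clip x y) * ennreal (clip x u) \<partial>std_normal \<partial>std_normal \<partial>std_normal)"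
      using nn_integral_std_gaussian_3[OF that, of "\<lambda>x y u. ennreal (clip x y * clip x u)"]
      by (simp add: ennreal_mult clip_nonneg)
    also have "\<dots> = (\<integral>\<^sup>+x. (ennreal (sqrt (2 / pi) * (1 - exp (- x\<^sup>2 / 2))))\<^sup>2 \<partial>std_normal)"
      by (simp add: nn_integral_cmult nn_integral_multc trunc power2_eq_square)
    finally show ?thesis unfolding \<kappa>_def nn_integral_std_normal_truncated_square .
  qed
  define g where "g z = (simpmin (z $ 1) (z $ 2) (z $ 3))\<^sup>2" for z :: "real^4"
  define sqr where "sqr i z = (z $ i)\<^sup>2" for i :: 4 and z :: "real^4"
  define prd where "prd i j z = \<bar>z $ i\<bar> * \<bar>z $ j\<bar>" for i j :: 4 and z :: "real^4"
  define low where "low i j k z = clip (z $ i) (z $ j) * clip (z $ i) (z $ k)" for i j k :: 4 and z :: "real^4"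
  note defs = g_def sqr_def prd_def low_def
  have g_meas [measurable]: "g \<in> borel_measurable borel"
    using measurable_compose[OF _ simpmin_measurable, of "\<lambda>z::real^4. (z $ 1, z $ 2, z $ 3)" borel]
    unfolding g_def by simp
  have [measurable]: "sqr i \<in> borel_measurable borel" "prd i j \<in> borel_measurable borel"
    "low i j k \<in> borel_measurable borel" for i j k
    unfolding defs by measurable
  have nonneg: "0 \<le> g z" "0 \<le> sqr i z" "0 \<le> prd i j z" "0 \<le> low i j k z" for i j k z
    by (simp_all add: defs clip_nonneg)
  note ints = square[of 1 2 3, folded sqr_def, simplified] square[of 2 1 3, folded sqr_def, simplified]
    square[of 3 1 2, folded sqr_def, simplified]
    prod[of 1 2 3, folded prd_def, simplified] prod[of 1 3 2, folded prd_def, simplified]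
    prod[of 2 3 1, folded prd_def, simplified]
    tail[of 1 2 3, folded low_def, simplified] tail[of 2 1 3, folded low_def, simplified]
    tail[of 3 1 2, folded low_def, simplified]
  \<comment> \<open>A negative value would be truncated to 0 by \<open>ennreal\<close>.\<close>
  have \<kappa>: "0 \<le> \<kappa>"
  proof -
    have "sqrt 2 \<le> 1.42" "sqrt 3 \<le> 1.74"
      by (rule real_le_lsqrt; simp add: power2_eq_square)+
    then have "1 / 1.74 \<le> 1 / sqrt 3" by (intro divide_left_mono) auto
    with \<open>sqrt 2 \<le> 1.42\<close> show ?thesis by (simp add: \<kappa>_def)
  qed
  \<comment> \<open>Finiteness of the second moment makes \<open>v\<close> its true value.\<close>
  have "?E g \<le> (\<integral>\<^sup>+z. ennreal (sqr 1 z) + (ennreal (sqr 2 z) + ennreal (sqr 3 z)) \<partial>std_gaussian)"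
  proof (rule nn_integral_mono)
    fix z
    have "ennreal (g z) \<le> ennreal (sqr 1 z + (sqr 2 z + sqr 3 z))"
      using simpmin_upper by (intro ennreal_leI) (simp add: defs add.assoc)
    then show "ennreal (g z) \<le> ennreal (sqr 1 z) + (ennreal (sqr 2 z) + ennreal (sqr 3 z))"
      by (simp add: ennreal_plus nonneg)
  qed
  also have "\<dots> < \<infinity>"
    by (simp add: nn_integral_add ints)
  finally obtain v where v: "0 \<le> v" "?E g = ennreal v"
    by (cases "?E g") auto
  \<comment> \<open>All terms stand on the side where they are added, so that no subtraction of
    extended reals occurs.\<close>
  have "(\<integral>\<^sup>+z. (ennreal (sqr 1 z) + (ennreal (sqr 2 z) + ennreal (sqr 3 z)))
      + 4 * (ennreal (low 1 2 3 z) + (ennreal (low 2 1 3 z) + ennreal (low 3 1 2 z))) \<partial>std_gaussian)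
    \<le> (\<integral>\<^sup>+z. 3 * ennreal (g z)
      + 2 * (ennreal (prd 1 2 z) + (ennreal (prd 1 3 z) + ennreal (prd 2 3 z))) \<partial>std_gaussian)"
  proof (rule nn_integral_mono)
    fix z
    have "ennreal ((sqr 1 z + (sqr 2 z + sqr 3 z)) + 4 * (low 1 2 3 z + (low 2 1 3 z + low 3 1 2 z)))
      \<le> ennreal (3 * g z + 2 * (prd 1 2 z + (prd 1 3 z + prd 2 3 z)))"
      using simpmin_lower by (intro ennreal_leI) (simp only: defs add.assoc)
    then show "(ennreal (sqr 1 z) + (ennreal (sqr 2 z) + ennreal (sqr 3 z)))
        + 4 * (ennreal (low 1 2 3 z) + (ennreal (low 2 1 3 z) + ennreal (low 3 1 2 z)))
      \<le> 3 * ennreal (g z) + 2 * (ennreal (prd 1 2 z) + (ennreal (prd 1 3 z) + ennreal (prd 2 3 z)))"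
      by (simp add: ennreal_plus ennreal_mult' nonneg)
  qed
  then have "(1 + (1 + 1)) + 4 * (ennreal \<kappa> + (ennreal \<kappa> + ennreal \<kappa>))
    \<le> 3 * ennreal v + 2 * (ennreal (2 / pi) + (ennreal (2 / pi) + ennreal (2 / pi)))"
    by (simp add: nn_integral_add nn_integral_cmult ints v)
  moreover have "ennreal ((1 + (1 + 1)) + 4 * (\<kappa> + (\<kappa> + \<kappa>))) = (1 + (1 + 1)) + 4 * (ennreal \<kappa> + (ennreal \<kappa> + ennreal \<kappa>))"
    using \<kappa> by (simp only: ennreal_plus ennreal_mult' ennreal_numeral ennreal_1 add_nonneg_nonneg mult_nonneg_nonneg zero_le_numeral zero_le_one)
  moreover have "ennreal (3 * v + 2 * (2 / pi + (2 / pi + 2 / pi)))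
    = 3 * ennreal v + 2 * (ennreal (2 / pi) + (ennreal (2 / pi) + ennreal (2 / pi)))"
    using v(1) pi_ge_zero by (simp only: ennreal_plus ennreal_mult' ennreal_numeral add_nonneg_nonneg mult_nonneg_nonneg zero_le_numeral divide_nonneg_nonneg)
  ultimately have "ennreal ((1 + (1 + 1)) + 4 * (\<kappa> + (\<kappa> + \<kappa>))) \<le> ennreal (3 * v + 2 * (2 / pi + (2 / pi + 2 / pi)))"
    by (simp only:)
  then have "3 + 12 * \<kappa> \<le> 3 * v + 12 / pi"
    using v(1) by (subst (asm) ennreal_le_iff) auto
  then have "1 + 4 * \<kappa> - 4 / pi \<le> v" by (simp add: field_simps)
  also have "v = (\<integral>z. (min_abs Sigma_simplex z)\<^sup>2 \<partial>std_gaussian)"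
    using integral_std_gaussian_orthogonal[OF orthogonal_rot_simplex g_meas nonneg(1)] v
    by (simp add: min_abs_Sigma_simplex g_def)
  finally show ?thesis unfolding \<kappa>_def .
qed

theorem theorem2p2:
  shows "(\<integral>z. (min_abs Sigma_cos z)\<^sup>2 \<partial>std_gaussian)
           < (\<integral>z. (min_abs Sigma_simplex z)\<^sup>2 \<partial>std_gaussian)
    \<and> \<not> (\<forall>A :: real^4^4. correlation_matrix A \<longrightarrow>
          (\<integral>z. (min_abs Sigma_simplex z)\<^sup>2 \<partial>std_gaussian)
            \<le> (\<integral>z. (min_abs A z)\<^sup>2 \<partial>std_gaussian))"
proof -
  \<comment> \<open>The expression \<open>4 - 6 * sqrt 2 + 8 / sqrt 3\<close> is about 0.13 and
    decreases in both roots, so upper bounds on the roots suffice.\<close>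
  have "sqrt 2 < 1.4143" "sqrt 3 < 1.7321"
    by (rule real_less_lsqrt; simp add: power2_eq_square)+
  then have "1 / 1.7321 < 1 / sqrt 3" by (intro divide_strict_left_mono) auto
  with \<open>sqrt 2 < 1.4143\<close> have "0 < 4 - 6 * sqrt 2 + 8 * (1 / sqrt 3)" by simp
  then have "0 < (4 - 6 * sqrt 2 + 8 * (1 / sqrt 3)) / pi" by simp
  also have "\<dots> = (1 + 4 * (2 / pi * (1 - sqrt 2 + 1 / sqrt 3)) - 4 / pi) - (1 - 2 * sqrt 2 / pi)"
    by (simp add: field_simps)
  finally have less: "(\<integral>z. (min_abs Sigma_cos z)\<^sup>2 \<partial>std_gaussian)
      < (\<integral>z. (min_abs Sigma_simplex z)\<^sup>2 \<partial>std_gaussian)"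
    using integral_min_abs_Sigma_cos integral_min_abs_Sigma_simplex by linarith
  \<comment> \<open>\<open>Sigma_cos\<close> itself is the counterexample; its diagonal entries are
    \<open>cos 0\<close>.\<close>
  have "correlation_matrix Sigma_cos"
    using psd_matrix_scaled_projection[OF Sigma_cos_transpose Sigma_cos_square]
    by (simp add: correlation_matrix_def Sigma_cos_def)
  with less show ?thesis by (meson not_less)
qed

end
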